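(* Let $\alpha>0$, $t_0>0$, $x_0,v_0\in\mathcal H$, and let $x$ be a solution of the Cauchy problem $$\tfrac{\alpha}{t}\dot x(t)+\operatorname{proj}_{C(x(t))+\ddot x(t)}(0)=0\ (t>t_0),\qquad x(t_0)=x_0,\ \dot x(t_0)=v_0 .$$ Then there exists a measurable function $\theta:[t_0,+\infty)\to\Delta^m$ with $$\operatorname{proj}_{C(x(t))+\ddot x(t)}(0)=\sum_{i=1}^m\theta_i(t)\nabla f_i(x(t))+\ddot x(t)\quad\text{for all }t\in[t_0,+\infty).$$
   Context: $\mathcal H$ is a real Hilbert space. $f_1,\dots,f_m:\mathcal H\to\mathbb R$ are convex and continuously differentiable. $C(x)=\operatorname{co}\{\nabla f_i(x):i=1,\dots,m\}$. For a closed convex $K$, $\operatorname{proj}_K(y)=\arg\min_{w\in K}\|w-y\|^2$. $\Delta^m=\{\theta\in\mathbb R^m:\theta\ge0,\ \sum_i\theta_i=1\}$. A solution of the Cauchy problem is a function $x:[t_0,+\infty)\to\mathcal H$ such that: $x\in C^1([t_0,+\infty))$; $\dot x$ is absolutely continuous on $[t_0,T]$ for every $T\ge t_0$; there is a Bochner measurable $\ddot x$ with $\dot x(t)=\dot x(t_0)+\int_{t_0}^t\ddot x(s)\,ds$ for all $t$, and $\frac{d}{dt}\dot x=\ddot x$ a.e.; the equation holds for almost all $t\ge t_0$; and the initial conditions hold. Here $\ddot x$ denotes this measurable function. *)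

theory Defs
  imports "HOL-Analysis.Analysis"
begin

text \<open>Metric projection onto a (closed convex) set K: the minimiser of norm (w - y)^2 over w in K.\<close>
definition proj :: "'a::real_inner set \<Rightarrow> 'a \<Rightarrow> 'a" where
  "proj K y = (SOME w. w \<in> K \<and> (\<forall>z\<in>K. (norm (w - y))\<^sup>2 \<le> (norm (z - y))\<^sup>2))"

text \<open>C(x) = co { grad f_i x : i = 1..m }, where g i is the gradient of f i.\<close>
definition Cset :: "nat \<Rightarrow> (nat \<Rightarrow> 'a::real_inner \<Rightarrow> 'a) \<Rightarrow> 'a \<Rightarrow> 'a set" where
  "Cset m g x = convex hull {g i x | i. i \<in> {1..m}}"

text \<open>The standard prob_simplex Delta^m, indices 1..m.\<close>
definition prob_simplex :: "nat \<Rightarrow> (nat \<Rightarrow> real) set" where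
  "prob_simplex m = {\<theta>. (\<forall>i\<in>{1..m}. 0 \<le> \<theta> i) \<and> (\<Sum>i=1..m. \<theta> i) = 1}"

end

theory Submission
  imports Defs
begin

text \<open>Off a null set the equation identifies the residual
  w(t) = proj (C(x(t)) + x''(t)) 0 - x''(t), a point of C(x(t)), with -(\<alpha>/t) x'(t) - x''(t), which is
  a pointwise limit of continuous difference quotients. Hence the inner products of w with itself
  and with the continuous vertices, the gradients of the f_i at x(t), are Lebesgue measurable, and only such inner products
  are used afterwards, so no separability of the Hilbert space is needed.

  Barycentric weights are selected one vertex at a time. Writing y = s a + (1 - s) u with a the
  last vertex and u in the hull H of the others, take s(t) least possible. Then s(t) \<le> b holds iff
  y(t) lies in the compact set of such combinations with s \<le> b, i.e. iff the distance from y(t) to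
  that set vanishes; by density of the rationals this distance is a countable infimum of distances
  to rescaled copies of H, which are measurable by induction on the number of vertices. The
  residual u = (y - s a) / (1 - s) then inherits measurable inner products, and induction
  finishes the selection.\<close>

section \<open>Truncated joins and least weights\<close>

definition join_upto :: "real \<Rightarrow> 'a::real_vector \<Rightarrow> 'a set \<Rightarrow> 'a set" where
  "join_upto b a H = {s *\<^sub>R a + (1 - s) *\<^sub>R u |s u. s \<in> {0..b} \<and> u \<in> H}"

lemma join_upto_nonempty:
  assumes "H \<noteq> {}" "0 \<le> b"
  shows "join_upto b a H \<noteq> {}"
proof -
  obtain u where "u \<in> H"
    using assms(1) by blast
  then have "0 *\<^sub>R a + (1 - 0) *\<^sub>R u \<in> join_upto b a H"
    using assms(2) unfolding join_upto_def by (intro CollectI exI[of _ 0] exI[of _ u]) simp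
  then show ?thesis
    by blast
qed

lemma compact_join_upto:
  fixes H :: "'a::real_normed_vector set"
  assumes "compact H"
  shows "compact (join_upto b a H)"
proof -
  have "join_upto b a H = (\<lambda>p. fst p *\<^sub>R a + (1 - fst p) *\<^sub>R snd p) ` ({0..b} \<times> H)"
    unfolding join_upto_def by force
  then show ?thesis
    using assms by (auto intro!: compact_continuous_image compact_Times continuous_intros)
qed

lemma convex_hull_insert_join_upto:
  fixes V :: "'a::real_vector set"
  assumes "V \<noteq> {}"
  shows "convex hull (insert a V) = join_upto 1 a (convex hull V)"
  unfolding convex_hull_insert[OF assms] join_upto_def
proof safe
  fix u v :: real and b assume "0 \<le> u" "0 \<le> v" "u + v = 1" "b \<in> convex hull V"
  then show "\<exists>s c. u *\<^sub>R a + v *\<^sub>R b = s *\<^sub>R a + (1 - s) *\<^sub>R c \<and> s \<in> {0..1} \<and> c \<in> convex hull V"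
    by (intro exI[of _ u] exI[of _ b]) auto
next
  fix s :: real and c assume "s \<in> {0..1}" "c \<in> convex hull V"
  then show "\<exists>u\<ge>0. \<exists>v\<ge>0. \<exists>b. u + v = 1 \<and> b \<in> convex hull V \<and> s *\<^sub>R a + (1 - s) *\<^sub>R c = u *\<^sub>R a + v *\<^sub>R b"
    by (intro exI[of _ s]) (auto intro!: exI[of _ "1 - s"])
qed

lemma convex_hull_Suc_join_upto:
  fixes v :: "nat \<Rightarrow> 'a::real_vector"
  assumes "1 \<le> k"
  shows "convex hull (v ` {1..Suc k}) = join_upto 1 (v (Suc k)) (convex hull (v ` {1..k}))"
  using assms by (simp add: atLeastAtMostSuc_conv convex_hull_insert_join_upto)

lemma Rats_near_in_Icc:
  fixes s b d :: real
  assumes "s \<in> {0..b}" "d > 0"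
  shows "\<exists>q\<in>\<rat>. q \<in> {0..b} \<and> \<bar>q - s\<bar> < d"
proof (cases "b = 0")
  case True
  then show ?thesis using assms by (intro bexI[of _ 0]) auto
next
  case False
  then have "max 0 (s - d) < min b (s + d)" using assms by auto
  then obtain q where "q \<in> \<rat>" "max 0 (s - d) < q" "q < min b (s + d)"
    using Rats_dense_in_real by blast
  then show ?thesis by (intro bexI[of _ q]) auto
qed

lemma infdist_image:
  assumes "A \<noteq> {}"
  shows "infdist y (f ` A) = (INF u\<in>A. dist y (f u))"
  using assms by (simp add: infdist_def image_image)

lemma infdist_scaled_join_upto_le:
  fixes H :: "'a::real_normed_vector set"
  assumes H: "H \<noteq> {}" and q: "q \<in> {0..b}"
  shows "infdist z ((*\<^sub>R) r ` join_upto b a H) \<le> infdist (z - (r * q) *\<^sub>R a) ((*\<^sub>R) (r * (1 - q)) ` H)"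
  unfolding infdist_image[OF H]
proof (intro cINF_greatest H)
  fix u assume "u \<in> H"
  then have "r *\<^sub>R (q *\<^sub>R a + (1 - q) *\<^sub>R u) \<in> (*\<^sub>R) r ` join_upto b a H"
    using q unfolding join_upto_def by blast
  then have "infdist z ((*\<^sub>R) r ` join_upto b a H) \<le> dist z (r *\<^sub>R (q *\<^sub>R a + (1 - q) *\<^sub>R u))"
    by (rule infdist_le)
  also have "\<dots> = dist (z - (r * q) *\<^sub>R a) ((r * (1 - q)) *\<^sub>R u)"
    by (simp add: dist_norm algebra_simps)
  finally show "infdist z ((*\<^sub>R) r ` join_upto b a H) \<le> dist (z - (r * q) *\<^sub>R a) ((r * (1 - q)) *\<^sub>R u)" .
qed

lemma INF_Rats_infdist_le_dist:
  fixes H :: "'a::real_normed_vector set"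
  assumes s: "s \<in> {0..b}" and u: "u \<in> H"
  shows "(INF q\<in>{0..b} \<inter> \<rat>. infdist (z - (r * q) *\<^sub>R a) ((*\<^sub>R) (r * (1 - q)) ` H))
    \<le> dist z (r *\<^sub>R (s *\<^sub>R a + (1 - s) *\<^sub>R u))" (is "(INF q\<in>?Q. ?D q) \<le> dist z (r *\<^sub>R ?w)")
proof (rule field_le_epsilon)
  fix e :: real assume "e > 0"
  define c where "c = \<bar>r\<bar> * norm (a - u) + 1"
  have "c > 0"
    unfolding c_def by (simp add: add_nonneg_pos)
  then obtain q where q: "q \<in> ?Q" and sq: "\<bar>q - s\<bar> < e / c"
    using Rats_near_in_Icc[OF s, of "e / c"] \<open>e > 0\<close> by auto
  \<comment> \<open>moving the weight of a from s to the nearby rational q costs at most e\<close>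
  have err: "\<bar>r\<bar> * \<bar>s - q\<bar> * norm (a - u) \<le> e"
  proof -
    have "\<bar>r\<bar> * \<bar>s - q\<bar> * norm (a - u) \<le> \<bar>s - q\<bar> * c"
      unfolding c_def by (simp add: algebra_simps)
    also have "\<dots> \<le> e"
      using sq \<open>c > 0\<close> by (simp add: pos_less_divide_eq abs_minus_commute)
    finally show ?thesis .
  qed
  have "bdd_below (?D ` ?Q)"
    by (auto intro: bdd_belowI[of _ 0] infdist_nonneg)
  then have "(INF q\<in>?Q. ?D q) \<le> ?D q"
    using q by (rule cINF_lower)
  also have "\<dots> \<le> dist (z - (r * q) *\<^sub>R a) ((r * (1 - q)) *\<^sub>R u)"
    using u by (intro infdist_le) auto
  also have "\<dots> = norm ((z - r *\<^sub>R ?w) + (r * (s - q)) *\<^sub>R (a - u))"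
    unfolding dist_norm by (simp add: algebra_simps)
  also have "\<dots> \<le> dist z (r *\<^sub>R ?w) + \<bar>r\<bar> * \<bar>s - q\<bar> * norm (a - u)"
    by (rule order_trans[OF norm_triangle_ineq]) (simp add: dist_norm abs_mult)
  finally show "(INF q\<in>?Q. ?D q) \<le> dist z (r *\<^sub>R ?w) + e"
    using err by linarith
qed

lemma infdist_scaled_join_upto:
  fixes H :: "'a::real_normed_vector set"
  assumes H: "H \<noteq> {}" and b: "0 \<le> b"
  shows "infdist z ((*\<^sub>R) r ` join_upto b a H) =
    (INF q\<in>{0..b} \<inter> \<rat>. infdist (z - (r * q) *\<^sub>R a) ((*\<^sub>R) (r * (1 - q)) ` H))"
proof (rule antisym)
  have "{0..b} \<inter> \<rat> \<noteq> {}"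
    using b by (auto intro!: exI[of _ 0])
  then show "infdist z ((*\<^sub>R) r ` join_upto b a H)
      \<le> (INF q\<in>{0..b} \<inter> \<rat>. infdist (z - (r * q) *\<^sub>R a) ((*\<^sub>R) (r * (1 - q)) ` H))"
    using H by (intro cINF_greatest infdist_scaled_join_upto_le) auto
  have "join_upto b a H \<noteq> {}"
    using H b by (rule join_upto_nonempty)
  then show "(INF q\<in>{0..b} \<inter> \<rat>. infdist (z - (r * q) *\<^sub>R a) ((*\<^sub>R) (r * (1 - q)) ` H))
      \<le> infdist z ((*\<^sub>R) r ` join_upto b a H)"
    unfolding infdist_image[OF \<open>join_upto b a H \<noteq> {}\<close>]
  proof (rule cINF_greatest)
    fix w assume "w \<in> join_upto b a H"
    then show "(INF q\<in>{0..b} \<inter> \<rat>. infdist (z - (r * q) *\<^sub>R a) ((*\<^sub>R) (r * (1 - q)) ` H))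
        \<le> dist z (r *\<^sub>R w)"
      unfolding join_upto_def by (auto intro: INF_Rats_infdist_le_dist)
  qed
qed

definition least_weight :: "'a::real_vector \<Rightarrow> 'a set \<Rightarrow> 'a \<Rightarrow> real" where
  "least_weight a H y = Inf {s \<in> {0..1}. \<exists>u\<in>H. y = s *\<^sub>R a + (1 - s) *\<^sub>R u}"

lemma least_weight_mem:
  fixes H :: "'a::real_normed_vector set"
  assumes H: "compact H" and y: "y \<in> join_upto 1 a H"
  shows "least_weight a H y \<in> {s \<in> {0..1}. \<exists>u\<in>H. y = s *\<^sub>R a + (1 - s) *\<^sub>R u}"
proof -
  let ?F = "{s \<in> {0..1}. \<exists>u\<in>H. y = s *\<^sub>R a + (1 - s) *\<^sub>R u}"
  let ?P = "({0..1} \<times> H) \<inter> {p. y = fst p *\<^sub>R a + (1 - fst p) *\<^sub>R snd p}"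
  have "closed {p :: real \<times> 'a. y = fst p *\<^sub>R a + (1 - fst p) *\<^sub>R snd p}"
    by (intro closed_Collect_eq continuous_intros)
  then have "compact ?P"
    using H by (intro compact_Int_closed compact_Times compact_Icc)
  have "fst ` ?P = ?F"
  proof
    show "fst ` ?P \<subseteq> ?F"
      by fastforce
    show "?F \<subseteq> fst ` ?P"
    proof
      fix s assume "s \<in> ?F"
      then obtain u where "s \<in> {0..1}" "u \<in> H" "y = s *\<^sub>R a + (1 - s) *\<^sub>R u"
        by blast
      then show "s \<in> fst ` ?P"
        by (intro image_eqI[of _ _ "(s, u)"]) auto
    qed
  qed
  moreover have "compact (fst ` ?P)"
    using \<open>compact ?P\<close> by (intro compact_continuous_image continuous_on_fst continuous_on_id)
  ultimately have "compact ?F"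
    by simp
  moreover have "?F \<noteq> {}"
    using y unfolding join_upto_def by auto
  ultimately show ?thesis
    unfolding least_weight_def
    by (intro closed_contains_Inf bounded_imp_bdd_below compact_imp_bounded compact_imp_closed)
qed

lemma least_weight_le_iff:
  fixes H :: "'a::real_normed_vector set"
  assumes "compact H" "y \<in> join_upto 1 a H" "b \<le> 1"
  shows "least_weight a H y \<le> b \<longleftrightarrow> y \<in> join_upto b a H"
proof
  assume "least_weight a H y \<le> b"
  with least_weight_mem[OF assms(1,2)] show "y \<in> join_upto b a H"
    unfolding join_upto_def by auto
next
  assume "y \<in> join_upto b a H"
  then obtain s u where s: "s \<in> {0..b}" and "u \<in> H" "y = s *\<^sub>R a + (1 - s) *\<^sub>R u"
    unfolding join_upto_def by auto
  then have "least_weight a H y \<le> s"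
    unfolding least_weight_def using assms(3) by (intro cInf_lower bdd_belowI[of _ 0]) auto
  then show "least_weight a H y \<le> b"
    using s by auto
qed

lemma least_weight_decomposition:
  fixes H :: "'a::real_normed_vector set"
  assumes "compact H" "y \<in> join_upto 1 a H" "h \<in> H"
  defines "s \<equiv> least_weight a H y"
  defines "u \<equiv> if s < 1 then (1 / (1 - s)) *\<^sub>R (y - s *\<^sub>R a) else h"
  shows "u \<in> H" and "y = s *\<^sub>R a + (1 - s) *\<^sub>R u"
proof -
  obtain w where s: "s \<in> {0..1}" and w: "w \<in> H" "y = s *\<^sub>R a + (1 - s) *\<^sub>R w"
    using least_weight_mem[OF assms(1,2)] unfolding s_def by auto
  have "u \<in> H \<and> y = s *\<^sub>R a + (1 - s) *\<^sub>R u"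
  proof (cases "s < 1")
    case True
    then have "u = w"
      unfolding u_def w(2) by simp
    then show ?thesis using w by simp
  next
    case False
    then show ?thesis
      using s w assms(3) unfolding u_def by simp
  qed
  then show "u \<in> H" "y = s *\<^sub>R a + (1 - s) *\<^sub>R u" by auto
qed

lemma least_weight_le_iff_infdist:
  fixes H :: "'a::real_normed_vector set"
  assumes H: "compact H" and y: "y \<in> join_upto 1 a H" and "0 \<le> b"
  shows "least_weight a H y \<le> b \<longleftrightarrow> infdist y (join_upto (min b 1) a H) = 0"
proof -
  have "H \<noteq> {}"
    using y unfolding join_upto_def by auto
  then have "join_upto (min b 1) a H \<noteq> {}"
    using \<open>0 \<le> b\<close> by (intro join_upto_nonempty) auto
  then have "y \<in> join_upto (min b 1) a H \<longleftrightarrow> infdist y (join_upto (min b 1) a H) = 0"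
    by (intro in_closed_iff_infdist_zero compact_imp_closed compact_join_upto H)
  moreover have "least_weight a H y \<le> b \<longleftrightarrow> least_weight a H y \<le> min b 1"
    using least_weight_mem[OF H y] by auto
  ultimately show ?thesis
    using least_weight_le_iff[OF H y, of "min b 1"] by simp
qed

lemma prob_simplex_join:
  assumes "\<theta> \<in> prob_simplex k" "s \<in> {0..1}"
  shows "(\<lambda>i. if i = Suc k then s else (1 - s) * \<theta> i) \<in> prob_simplex (Suc k)"
proof -
  have "(\<Sum>i=1..k. (if i = Suc k then s else (1 - s) * \<theta> i)) = (1 - s) * (\<Sum>i=1..k. \<theta> i)"
    by (simp add: sum_distrib_left)
  then show ?thesis
    using assms unfolding prob_simplex_def by (auto simp: le_Suc_eq)
qed

lemma sum_join_weights:
  fixes v :: "nat \<Rightarrow> 'a::real_vector"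
  shows "(\<Sum>i=1..Suc k. (if i = Suc k then s else (1 - s) * \<theta> i) *\<^sub>R v i)
    = s *\<^sub>R v (Suc k) + (1 - s) *\<^sub>R (\<Sum>i=1..k. \<theta> i *\<^sub>R v i)"
proof -
  have "(\<Sum>i=1..k. (if i = Suc k then s else (1 - s) * \<theta> i) *\<^sub>R v i) = (1 - s) *\<^sub>R (\<Sum>i=1..k. \<theta> i *\<^sub>R v i)"
    by (simp add: scaleR_sum_right)
  then show ?thesis
    by simp
qed

section \<open>Measurability through inner products\<close>

text \<open>Stands in for Borel measurability of y, which is awkward in a nonseparable Hilbert space.\<close>

definition gram_measurable :: "'b measure \<Rightarrow> (nat \<Rightarrow> 'b \<Rightarrow> 'a::real_inner) \<Rightarrow> ('b \<Rightarrow> 'a) \<Rightarrow> bool" where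
  "gram_measurable M v y \<longleftrightarrow>
     (\<lambda>t. y t \<bullet> y t) \<in> borel_measurable M \<and> (\<forall>i. (\<lambda>t. y t \<bullet> v i t) \<in> borel_measurable M)"

lemma gram_measurable_If:
  assumes "gram_measurable M v y" "gram_measurable M v z" "Measurable.pred M P"
  shows "gram_measurable M v (\<lambda>t. if P t then y t else z t)"
proof -
  have "(\<lambda>t. (if P t then y t else z t) \<bullet> (if P t then y t else z t))
      = (\<lambda>t. if P t then y t \<bullet> y t else z t \<bullet> z t)"
    "(\<lambda>t. (if P t then y t else z t) \<bullet> v i t) = (\<lambda>t. if P t then y t \<bullet> v i t else z t \<bullet> v i t)" for i
    by auto
  with assms show ?thesis
    unfolding gram_measurable_def by (simp add: measurable_If)
qed

lemma gram_measurable_scaleR: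
  assumes "gram_measurable M v y" "c \<in> borel_measurable M"
  shows "gram_measurable M v (\<lambda>t. c t *\<^sub>R y t)"
  using assms unfolding gram_measurable_def by (simp add: borel_measurable_times)

lemma measurable_weights_join:
  fixes v :: "nat \<Rightarrow> 'b \<Rightarrow> 'a::real_vector"
  assumes s: "s \<in> borel_measurable M" "\<And>t. t \<in> space M \<Longrightarrow> s t \<in> {0..1}"
    and \<theta>: "\<And>i. (\<lambda>t. \<theta> t i) \<in> borel_measurable M"
    and \<theta>_simplex: "\<And>t. t \<in> space M \<Longrightarrow> \<theta> t \<in> prob_simplex k"
    and y: "\<And>t. t \<in> space M \<Longrightarrow> y t = s t *\<^sub>R v (Suc k) t + (1 - s t) *\<^sub>R (\<Sum>i=1..k. \<theta> t i *\<^sub>R v i t)"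
  shows "\<exists>\<theta>'. (\<forall>i. (\<lambda>t. \<theta>' t i) \<in> borel_measurable M) \<and>
    (\<forall>t\<in>space M. \<theta>' t \<in> prob_simplex (Suc k) \<and> y t = (\<Sum>i=1..Suc k. \<theta>' t i *\<^sub>R v i t))"
proof (intro exI conjI allI ballI)
  let ?\<theta> = "\<lambda>t i. if i = Suc k then s t else (1 - s t) * \<theta> t i"
  show "(\<lambda>t. ?\<theta> t i) \<in> borel_measurable M" for i
    using s(1) \<theta>[of i] by (cases "i = Suc k") simp_all
  fix t assume t: "t \<in> space M"
  show "?\<theta> t \<in> prob_simplex (Suc k)"
    by (rule prob_simplex_join[OF \<theta>_simplex[OF t] s(2)[OF t]])
  show "y t = (\<Sum>i=1..Suc k. ?\<theta> t i *\<^sub>R v i t)"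
    unfolding sum_join_weights[where v = "\<lambda>i. v i t"] by (rule y[OF t])
qed

context
  fixes M :: "'b measure" and v :: "nat \<Rightarrow> 'b \<Rightarrow> 'a::real_inner"
  assumes gram: "\<And>i j. (\<lambda>t. v i t \<bullet> v j t) \<in> borel_measurable M"
begin

lemma gram_measurable_vertex: "gram_measurable M v (v j)"
  unfolding gram_measurable_def using gram by auto

lemma gram_measurable_diff_scaleR:
  assumes y: "gram_measurable M v y" and c: "c \<in> borel_measurable M"
  shows "gram_measurable M v (\<lambda>t. y t - c t *\<^sub>R v j t)"
proof -
  have [measurable]: "(\<lambda>t. y t \<bullet> y t) \<in> borel_measurable M" "(\<lambda>t. y t \<bullet> v i t) \<in> borel_measurable M"
    "(\<lambda>t. v i t \<bullet> v j t) \<in> borel_measurable M" "c \<in> borel_measurable M" for i j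
    using y c gram unfolding gram_measurable_def by auto
  have square: "(\<lambda>t. (y t - c t *\<^sub>R v j t) \<bullet> (y t - c t *\<^sub>R v j t))
      = (\<lambda>t. y t \<bullet> y t - 2 * c t * (y t \<bullet> v j t) + c t * c t * (v j t \<bullet> v j t))"
    by (auto simp: inner_diff_left inner_diff_right inner_commute[of "v j _" "y _"] algebra_simps)
  have cross: "(\<lambda>t. (y t - c t *\<^sub>R v j t) \<bullet> v i t) = (\<lambda>t. y t \<bullet> v i t - c t * (v j t \<bullet> v i t))" for i
    by (auto simp: inner_diff_left)
  show ?thesis
    unfolding gram_measurable_def square cross by measurable
qed

lemma borel_measurable_infdist_scaled_join_upto:
  assumes H: "\<And>t. H t \<noteq> {}"
    and infdist_H: "\<And>z r. gram_measurable M v z \<Longrightarrow>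
      (\<lambda>t. infdist (z t) ((*\<^sub>R) r ` H t)) \<in> borel_measurable M"
    and z: "gram_measurable M v z" and b: "0 \<le> b"
  shows "(\<lambda>t. infdist (z t) ((*\<^sub>R) r ` join_upto b (v j t) (H t))) \<in> borel_measurable M"
proof -
  have "countable ({0..b} \<inter> \<rat>)"
    by (rule countable_subset[OF _ countable_rat]) auto
  moreover have "(\<lambda>t. infdist (z t - (r * q) *\<^sub>R v j t) ((*\<^sub>R) (r * (1 - q)) ` H t))
      \<in> borel_measurable M" for q
    using gram_measurable_diff_scaleR[OF z, of "\<lambda>_. r * q"] by (intro infdist_H) simp
  ultimately show ?thesis
    unfolding infdist_scaled_join_upto[OF H b] by (rule borel_measurable_cINF_real)
qed

lemma borel_measurable_infdist_scaled_hull: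
  assumes "1 \<le> k" "gram_measurable M v z"
  shows "(\<lambda>t. infdist (z t) ((*\<^sub>R) r ` (convex hull ((\<lambda>i. v i t) ` {1..k})))) \<in> borel_measurable M"
  using assms
proof (induction k arbitrary: z r rule: nat_induct_at_least)
  case base
  have "gram_measurable M v (\<lambda>t. z t - r *\<^sub>R v 1 t)"
    using gram_measurable_diff_scaleR[OF base] by simp
  then have [measurable]: "(\<lambda>t. (z t - r *\<^sub>R v 1 t) \<bullet> (z t - r *\<^sub>R v 1 t)) \<in> borel_measurable M"
    unfolding gram_measurable_def by simp
  have "(\<lambda>t. sqrt ((z t - r *\<^sub>R v 1 t) \<bullet> (z t - r *\<^sub>R v 1 t))) \<in> borel_measurable M"
    by measurable
  then show ?case
    by (simp add: dist_norm norm_eq_sqrt_inner)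
next
  case (Suc k)
  have "(\<lambda>t. infdist (z t) ((*\<^sub>R) r ` join_upto 1 (v (Suc k) t) (convex hull ((\<lambda>i. v i t) ` {1..k}))))
      \<in> borel_measurable M"
    by (rule borel_measurable_infdist_scaled_join_upto[OF _ Suc.IH Suc.prems]) (use Suc.hyps in auto)
  moreover have "convex hull ((\<lambda>i. v i t) ` {1..Suc k})
      = join_upto 1 (v (Suc k) t) (convex hull ((\<lambda>i. v i t) ` {1..k}))" for t
    by (rule convex_hull_Suc_join_upto[OF Suc.hyps(1)])
  ultimately show ?case
    by simp
qed

lemma borel_measurable_least_weight:
  assumes "1 \<le> k" "gram_measurable M v y"
    and y: "\<And>t. t \<in> space M \<Longrightarrow> y t \<in> convex hull ((\<lambda>i. v i t) ` {1..Suc k})"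
  shows "(\<lambda>t. least_weight (v (Suc k) t) (convex hull ((\<lambda>i. v i t) ` {1..k})) (y t))
    \<in> borel_measurable M" (is "?s \<in> _")
  unfolding borel_measurable_iff_le
proof
  fix b :: real
  define H where "H t = convex hull ((\<lambda>i. v i t) ` {1..k})" for t
  have H: "compact (H t)" "H t \<noteq> {}" for t
    unfolding H_def using \<open>1 \<le> k\<close> by (auto intro: finite_imp_compact_convex_hull)
  have y_join: "y t \<in> join_upto 1 (v (Suc k) t) (H t)" if "t \<in> space M" for t
    using y[OF that] convex_hull_Suc_join_upto[OF \<open>1 \<le> k\<close>, of "\<lambda>i. v i t"] unfolding H_def by simp
  show "{t \<in> space M. ?s t \<le> b} \<in> sets M"
  proof (cases "b < 0")
    case True
    then have "{t \<in> space M. ?s t \<le> b} = {}"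
      using least_weight_mem[OF H(1) y_join] unfolding H_def by force
    then show ?thesis
      by (metis sets.empty_sets)
  next
    case False
    let ?d = "\<lambda>t. infdist (y t) (join_upto (min b 1) (v (Suc k) t) (H t))"
    have "{t \<in> space M. ?s t \<le> b} = {t \<in> space M. ?d t = 0}"
      using least_weight_le_iff_infdist[OF H(1) y_join] False unfolding H_def by auto
    moreover have "(\<lambda>t. infdist (y t) ((*\<^sub>R) 1 ` join_upto (min b 1) (v (Suc k) t) (H t)))
        \<in> borel_measurable M"
    proof (rule borel_measurable_infdist_scaled_join_upto)
      show "(\<lambda>t. infdist (z t) ((*\<^sub>R) r ` H t)) \<in> borel_measurable M"
        if "gram_measurable M v z" for z r
        unfolding H_def using \<open>1 \<le> k\<close> that by (rule borel_measurable_infdist_scaled_hull)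
    qed (use H(2) False assms(2) in auto)
    then have [measurable]: "?d \<in> borel_measurable M"
      by simp
    ultimately show ?thesis
      by simp
  qed
qed

lemma measurable_convex_weights:
  assumes "1 \<le> k" "gram_measurable M v y"
    and "\<And>t. t \<in> space M \<Longrightarrow> y t \<in> convex hull ((\<lambda>i. v i t) ` {1..k})"
  shows "\<exists>\<theta>. (\<forall>i. (\<lambda>t. \<theta> t i) \<in> borel_measurable M) \<and>
    (\<forall>t\<in>space M. \<theta> t \<in> prob_simplex k \<and> y t = (\<Sum>i=1..k. \<theta> t i *\<^sub>R v i t))"
  using assms
proof (induction k arbitrary: y rule: nat_induct_at_least)
  case base
  then show ?case
    by (intro exI[of _ "\<lambda>t i. 1"]) (auto simp: prob_simplex_def)
next
  case (Suc k)
  define H where "H t = convex hull ((\<lambda>i. v i t) ` {1..k})" for t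
  define s where "s t = least_weight (v (Suc k) t) (H t) (y t)" for t
  \<comment> \<open>where the weight is 1, y t is the last vertex and any point of H t serves as residual\<close>
  define u where "u t = (if s t < 1 then (1 / (1 - s t)) *\<^sub>R (y t - s t *\<^sub>R v (Suc k) t) else v 1 t)" for t
  have H: "compact (H t)" "v 1 t \<in> H t" for t
    unfolding H_def using Suc.hyps by (auto intro: finite_imp_compact_convex_hull hull_inc)
  have y_join: "y t \<in> join_upto 1 (v (Suc k) t) (H t)" if "t \<in> space M" for t
    using Suc.prems(2)[OF that] convex_hull_Suc_join_upto[OF Suc.hyps, of "\<lambda>i. v i t"]
    unfolding H_def by simp
  have s01: "s t \<in> {0..1}" if "t \<in> space M" for t
    using least_weight_mem[OF H(1) y_join[OF that]] unfolding s_def by auto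
  have u: "u t \<in> H t" "y t = s t *\<^sub>R v (Suc k) t + (1 - s t) *\<^sub>R u t" if "t \<in> space M" for t
    using least_weight_decomposition[OF H(1) y_join[OF that] H(2)] unfolding s_def u_def by auto
  have [measurable]: "s \<in> borel_measurable M"
    unfolding s_def H_def using Suc.hyps Suc.prems by (rule borel_measurable_least_weight)
  have "gram_measurable M v u"
    unfolding u_def using Suc.prems(1)
    by (intro gram_measurable_If gram_measurable_scaleR gram_measurable_diff_scaleR gram_measurable_vertex)
      measurable
  then obtain \<theta> where "\<And>i. (\<lambda>t. \<theta> t i) \<in> borel_measurable M"
    and "\<And>t. t \<in> space M \<Longrightarrow> \<theta> t \<in> prob_simplex k \<and> u t = (\<Sum>i=1..k. \<theta> t i *\<^sub>R v i t)"
    using Suc.IH u(1) unfolding H_def by blast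
  with s01 u(2) show ?case
    by (intro measurable_weights_join[where s = s]) auto
qed

end

section \<open>Almost everywhere limits of continuous functions\<close>

lemma borel_measurable_lebesgue_on_AE_cong:
  fixes f g :: "'a::euclidean_space \<Rightarrow> 'b::euclidean_space"
  assumes S: "S \<in> sets lebesgue" and f: "f \<in> borel_measurable (lebesgue_on S)"
    and fg: "AE x in lebesgue. x \<in> S \<longrightarrow> f x = g x"
  shows "g \<in> borel_measurable (lebesgue_on S)"
proof -
  have S': "S \<inter> space lebesgue \<in> sets lebesgue"
    using S by simp
  have "AE x in lebesgue. indicator S x *\<^sub>R f x = indicator S x *\<^sub>R g x"
    using fg by eventually_elim (auto simp: indicator_def)
  with f show ?thesis
    unfolding borel_measurable_restrict_space_iff[OF S'] by (rule borel_measurable_AE)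
qed

lemma borel_measurable_inner_of_AE_limits:
  fixes f g :: "real \<Rightarrow> 'a::real_inner"
  assumes F: "\<And>n. continuous_on {t0..} (F n)" and G: "\<And>n. continuous_on {t0..} (G n)"
    and F_lim: "AE t in lebesgue. t > t0 \<longrightarrow> (\<lambda>n. F n t) \<longlonglongrightarrow> f t"
    and G_lim: "AE t in lebesgue. t > t0 \<longrightarrow> (\<lambda>n. G n t) \<longlonglongrightarrow> g t"
  shows "(\<lambda>t. f t \<bullet> g t) \<in> borel_measurable (lebesgue_on {t0..})"
proof (rule borel_measurable_lebesgue_on_AE_cong)
  show "(\<lambda>t. lim (\<lambda>n. F n t \<bullet> G n t)) \<in> borel_measurable (lebesgue_on {t0..})"
    by (intro borel_measurable_lim_metric continuous_imp_measurable_on_sets_lebesgue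
        continuous_intros F G) auto
  have "AE t in lebesgue. t \<noteq> t0"
    by (rule AE_completion) (rule AE_lborel_singleton)
  with F_lim G_lim show "AE t in lebesgue. t \<in> {t0..} \<longrightarrow> lim (\<lambda>n. F n t \<bullet> G n t) = f t \<bullet> g t"
    by eventually_elim (auto intro!: limI tendsto_inner)
qed simp

lemma gram_measurable_of_AE_limits:
  fixes y :: "real \<Rightarrow> 'a::real_inner"
  assumes Y: "\<And>n. continuous_on {t0..} (Y n)" and v: "\<And>i. continuous_on {t0..} (v i)"
    and Y_lim: "AE t in lebesgue. t > t0 \<longrightarrow> (\<lambda>n. Y n t) \<longlonglongrightarrow> y t"
  shows "gram_measurable (lebesgue_on {t0..}) v y"
  unfolding gram_measurable_def
proof (intro conjI allI)
  show "(\<lambda>t. y t \<bullet> y t) \<in> borel_measurable (lebesgue_on {t0..})"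
    by (rule borel_measurable_inner_of_AE_limits[OF Y Y Y_lim Y_lim])
  show "(\<lambda>t. y t \<bullet> v i t) \<in> borel_measurable (lebesgue_on {t0..})" for i
    by (rule borel_measurable_inner_of_AE_limits[where G = "\<lambda>n. v i", OF Y v Y_lim]) simp
qed

lemma tendsto_difference_quotient_right:
  fixes f :: "real \<Rightarrow> 'a::real_normed_vector"
  assumes f: "(f has_vector_derivative f') (at t within {t0..})" and "t0 \<le> t"
    and h: "h \<longlonglongrightarrow> 0" "\<And>n. h n > 0"
  shows "(\<lambda>n. (1 / h n) *\<^sub>R (f (t + h n) - f t)) \<longlonglongrightarrow> f'"
proof -
  have lim: "((\<lambda>y. (1 / norm (y - t)) *\<^sub>R (f y - (f t + (y - t) *\<^sub>R f'))) \<longlongrightarrow> 0) (at t within {t0..})"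
    using f unfolding has_vector_derivative_def has_derivative_within by simp
  have "(\<lambda>n. t + h n) \<longlonglongrightarrow> t"
    using tendsto_add[OF tendsto_const h(1)] by simp
  moreover have "t + h n \<in> {t0..} \<and> t + h n \<noteq> t" for n
    using \<open>t0 \<le> t\<close> h(2)[of n] by simp
  ultimately have "filterlim (\<lambda>n. t + h n) (at t within {t0..}) sequentially"
    unfolding filterlim_at by (simp add: always_eventually)
  from filterlim_compose[OF lim this]
  have "(\<lambda>n. (1 / norm (h n)) *\<^sub>R (f (t + h n) - (f t + h n *\<^sub>R f'))) \<longlonglongrightarrow> 0"
    by simp
  moreover have "(1 / norm (h n)) *\<^sub>R (f (t + h n) - (f t + h n *\<^sub>R f'))
      = (1 / h n) *\<^sub>R (f (t + h n) - f t) - f'" for n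
    using h(2)[of n] by (simp add: scaleR_diff_right scaleR_add_right diff_diff_add)
  ultimately show ?thesis
    by (simp add: LIM_zero_iff)
qed

lemma AE_derivative_limit_of_continuous:
  fixes x' x'' :: "real \<Rightarrow> 'a::real_normed_vector"
  assumes cont: "continuous_on {t0..} x'"
    and deriv: "AE t in lebesgue. t \<ge> t0 \<longrightarrow> (x' has_vector_derivative x'' t) (at t within {t0..})"
  obtains \<psi> where "\<And>n. continuous_on {t0..} (\<psi> n)"
    and "AE t in lebesgue. t \<ge> t0 \<longrightarrow> (\<lambda>n. \<psi> n t) \<longlonglongrightarrow> x'' t"
proof
  define h where "h n = inverse (real (Suc n))" for n
  have h: "h \<longlonglongrightarrow> 0" "h n > 0" for n
    unfolding h_def using LIMSEQ_inverse_real_of_nat by simp_all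
  show "continuous_on {t0..} (\<lambda>t. (1 / h n) *\<^sub>R (x' (t + h n) - x' t))" for n
  proof -
    have "continuous_on {t0..} (\<lambda>t. x' (t + h n))"
      using h(2)[of n] by (intro continuous_on_compose2[OF cont] continuous_intros) auto
    then show ?thesis
      by (intro continuous_intros cont)
  qed
  show "AE t in lebesgue. t \<ge> t0 \<longrightarrow> (\<lambda>n. (1 / h n) *\<^sub>R (x' (t + h n) - x' t)) \<longlonglongrightarrow> x'' t"
    using deriv by eventually_elim (blast intro: tendsto_difference_quotient_right h)
qed

section \<open>Selection of the weights along the trajectory\<close>

lemma proj_in:
  fixes K :: "'a::real_inner set"
  assumes "compact K" "K \<noteq> {}"
  shows "proj K y \<in> K"
proof -
  have "continuous_on K (\<lambda>w. (norm (w - y))\<^sup>2)"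
    by (intro continuous_intros)
  then obtain w where "w \<in> K" "\<forall>z\<in>K. (norm (w - y))\<^sup>2 \<le> (norm (z - y))\<^sup>2"
    using continuous_attains_inf[OF assms] by blast
  then show ?thesis
    unfolding proj_def by (intro someI2_ex[where Q = "\<lambda>w. w \<in> K"]) blast+
qed

lemma proj_translation_minus_in:
  fixes C :: "'a::real_inner set"
  assumes "compact C" "C \<noteq> {}"
  shows "proj ((\<lambda>c. c + d) ` C) 0 - d \<in> C"
proof -
  have "compact ((\<lambda>c. c + d) ` C)"
    using assms(1) by (intro compact_continuous_image continuous_intros)
  then have "proj ((\<lambda>c. c + d) ` C) 0 \<in> (\<lambda>c. c + d) ` C"
    using assms(2) by (intro proj_in) auto
  then show ?thesis by auto
qed

theorem lemma4p3:
  fixes f :: "nat \<Rightarrow> 'a::{real_inner, complete_space} \<Rightarrow> real"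
    and g :: "nat \<Rightarrow> 'a \<Rightarrow> 'a"
    and m :: nat and \<alpha> t0 :: real and x0 v0 :: 'a
    and x x' x'' :: "real \<Rightarrow> 'a"
  assumes m: "m \<ge> 1"
    and convex: "\<And>i. i \<in> {1..m} \<Longrightarrow> convex_on UNIV (f i)"
    and grad: "\<And>i y. i \<in> {1..m} \<Longrightarrow> (f i has_derivative (\<lambda>h. g i y \<bullet> h)) (at y)"
    and grad_cont: "\<And>i. i \<in> {1..m} \<Longrightarrow> continuous_on UNIV (g i)"
    and \<alpha>: "\<alpha> > 0" and t0: "t0 > 0"
    and x_C1: "\<And>t. t \<ge> t0 \<Longrightarrow> (x has_vector_derivative x' t) (at t within {t0..})"
    and x'_cont: "continuous_on {t0..} x'"
    and x''_meas: "x'' \<in> borel_measurable (restrict_space lebesgue {t0..})"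
    and x''_int: "\<And>t. t \<ge> t0 \<Longrightarrow> (x'' has_integral (x' t - x' t0)) {t0..t}"
    and x''_abs: "\<And>t. t \<ge> t0 \<Longrightarrow> (\<lambda>s. norm (x'' s)) integrable_on {t0..t}"
    and x''_deriv: "AE t in lebesgue. t \<ge> t0 \<longrightarrow> (x' has_vector_derivative x'' t) (at t within {t0..})"
    and eq: "AE t in lebesgue. t > t0 \<longrightarrow>
               (\<alpha> / t) *\<^sub>R x' t + proj ((\<lambda>c. c + x'' t) ` Cset m g (x t)) 0 = 0"
    and init: "x t0 = x0" "x' t0 = v0"
  shows "\<exists>\<theta> :: real \<Rightarrow> nat \<Rightarrow> real.
           (\<forall>i\<in>{1..m}. (\<lambda>t. \<theta> t i) \<in> borel_measurable (restrict_space lebesgue {t0..})) \<and>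
           (\<forall>t\<ge>t0. \<theta> t \<in> prob_simplex m \<and>
              proj ((\<lambda>c. c + x'' t) ` Cset m g (x t)) 0
                = (\<Sum>i=1..m. \<theta> t i *\<^sub>R g i (x t)) + x'' t)"
proof -
  \<comment> \<open>the vertices are extended by 0 outside 1..m so that all of them are continuous\<close>
  define v where "v i t = (if i \<in> {1..m} then g i (x t) else 0)" for i t
  define w where "w t = proj ((\<lambda>c. c + x'' t) ` Cset m g (x t)) 0 - x'' t" for t
  have hull: "Cset m g (x t) = convex hull ((\<lambda>i. v i t) ` {1..m})" for t
    unfolding Cset_def v_def by (rule arg_cong[where f = "\<lambda>S. convex hull S"]) auto
  have "continuous_on {t0..} x"
    using x_C1 by (intro continuous_on_vector_derivative) auto
  then have v_cont: "continuous_on {t0..} (v i)" for i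
    unfolding v_def using grad_cont by (cases "i \<in> {1..m}") (auto intro: continuous_on_compose2)
  obtain \<psi> where \<psi>: "\<And>n. continuous_on {t0..} (\<psi> n)"
    and x''_lim: "AE t in lebesgue. t \<ge> t0 \<longrightarrow> (\<lambda>n. \<psi> n t) \<longlonglongrightarrow> x'' t"
    using AE_derivative_limit_of_continuous[OF x'_cont x''_deriv] by blast
  have "continuous_on {t0..} (\<lambda>t. - (\<alpha> / t) *\<^sub>R x' t - \<psi> n t)" for n
    using t0 by (intro continuous_intros x'_cont \<psi>) auto
  moreover have "AE t in lebesgue. t > t0 \<longrightarrow> (\<lambda>n. - (\<alpha> / t) *\<^sub>R x' t - \<psi> n t) \<longlonglongrightarrow> w t"
    using eq x''_lim by eventually_elim (auto simp: w_def add_eq_0_iff intro: tendsto_diff)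
  ultimately have w_gram: "gram_measurable (lebesgue_on {t0..}) v w"
    by (intro gram_measurable_of_AE_limits v_cont)
  have vv: "(\<lambda>t. v i t \<bullet> v j t) \<in> borel_measurable (lebesgue_on {t0..})" for i j
    by (intro continuous_imp_measurable_on_sets_lebesgue continuous_intros v_cont) auto
  have w_hull: "w t \<in> convex hull ((\<lambda>i. v i t) ` {1..m})" for t
    unfolding w_def hull using m by (intro proj_translation_minus_in finite_imp_compact_convex_hull) auto
  obtain \<theta> where "\<forall>i. (\<lambda>t. \<theta> t i) \<in> borel_measurable (lebesgue_on {t0..})"
    and "\<forall>t\<in>space (lebesgue_on {t0..}). \<theta> t \<in> prob_simplex m \<and> w t = (\<Sum>i=1..m. \<theta> t i *\<^sub>R v i t)"
    using measurable_convex_weights[OF vv m w_gram w_hull] by blast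
  moreover have "(\<Sum>i=1..m. \<theta> t i *\<^sub>R v i t) = (\<Sum>i=1..m. \<theta> t i *\<^sub>R g i (x t))" for t
    unfolding v_def by simp
  ultimately show ?thesis
    unfolding w_def by (auto simp: diff_eq_eq space_restrict_space)
qed

end
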